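(* Let $\nu$ be a finite measure on $\mathcal{B}(\mathbb{X}\times\mathbb{Y})$ and let $P$ be a probability measure on $\mathcal{B}(\mathbb{X})$. Suppose $\mathcal{Q}$ is a set of channels from $\mathbb{X}$ to $\mathbb{Y}$ such that $$PQ\le\nu\quad\text{for all }Q\in\mathcal{Q}.$$ Then $\mathcal{Q}$ is setwise precompact at input $P$, in the sense that any sequence in $\mathcal{Q}$ has a subsequence $\{Q_n\}$ such that $Q_n\to Q$ setwise at input $P$ for some channel $Q$ from $\mathbb{X}$ to $\mathbb{Y}$.
   Context: $\mathbb{X}=\mathbb{R}^n$, $\mathbb{Y}=\mathbb{R}^m$, and $\mathcal{B}(\cdot)$ denotes the Borel $\sigma$-algebra. A channel $Q$ is a stochastic kernel from $\mathbb{X}$ to $\mathbb{Y}$: $Q(\cdot|x)$ is a Borel probability measure on $\mathbb{Y}$ for every $x\in\mathbb{X}$, and $x\mapsto Q(A|x)$ is Borel measurable for every Borel $A\subset\mathbb{Y}$. $PQ$ is the joint probability measure on $\mathbb{X}\times\mathbb{Y}$ given by $PQ(A)=\int_A Q(dy|x)P(dx)$. For finite measures, $\mu\le\nu$ means $\mu(A)\le\nu(A)$ for all measurable $A$. $Q_n\to Q$ setwise at input $P$ means $PQ_n(A)\to PQ(A)$ for every Borel $A\subset\mathbb{X}\times\mathbb{Y}$. The limit channel need not belong to $\mathcal{Q}$. *)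

theory Defs
  imports "HOL-Probability.Probability"
begin

definition channel :: "(real^'n \<Rightarrow> (real^'m) measure) \<Rightarrow> bool" where
  "channel Q \<longleftrightarrow>
     (\<forall>x. prob_space (Q x) \<and> sets (Q x) = sets borel) \<and>
     (\<forall>A \<in> sets borel. (\<lambda>x. measure (Q x) A) \<in> borel_measurable borel)"

lemma channel_iff_prob_algebra: "channel Q \<longleftrightarrow> Q \<in> borel \<rightarrow>\<^sub>M prob_algebra borel"
proof
  assume Q: "channel Q"
  show "Q \<in> borel \<rightarrow>\<^sub>M prob_algebra borel"
  proof (rule measurable_prob_algebraI)
    show "prob_space (Q x)" for x using Q by (simp add: channel_def)
    show "Q \<in> borel \<rightarrow>\<^sub>M subprob_algebra borel"
    proof (rule measurable_subprob_algebra)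
      fix x
      show "subprob_space (Q x)" using Q
        by (simp add: channel_def prob_space_imp_subprob_space)
      show "sets (Q x) = sets borel" using Q by (simp add: channel_def)
    next
      fix A :: "(real^'b) set" assume "A \<in> sets borel"
      then have "(\<lambda>x. ennreal (measure (Q x) A)) \<in> borel_measurable borel"
        using Q by (auto simp: channel_def)
      moreover have "emeasure (Q x) A = ennreal (measure (Q x) A)" for x
        using Q by (simp add: channel_def prob_space.finite_measure finite_measure.emeasure_eq_measure)
      ultimately show "(\<lambda>x. emeasure (Q x) A) \<in> borel_measurable borel" by simp
    qed
  qed
next
  assume Q: "Q \<in> borel \<rightarrow>\<^sub>M prob_algebra borel"
  have "prob_space (Q x) \<and> sets (Q x) = sets borel" for x
    using measurable_space[OF Q, of x] by (simp add: space_prob_algebra)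
  moreover have "(\<lambda>x. measure (Q x) A) \<in> borel_measurable borel" if "A \<in> sets borel" for A
    using measurable_compose[OF measurable_prob_algebraD[OF Q] measurable_measure_subprob_algebra[OF that]] .
  ultimately show "channel Q" by (simp add: channel_def)
qed

text \<open>
  The joint measure \<open>PQ\<close>, where \<open>\<integral>\<^sub>A Q(dy|x) P(dx)\<close> is read as the iterated integral
  of the indicator of \<open>A\<close>, i.e. the \<open>P\<close>-integral of the mass that \<open>Q x\<close> gives to the section
  of \<open>A\<close> at \<open>x\<close>. The Borel sets of the product type coincide with the product of the
  two Borel \<open>\<sigma>\<close>-algebras (\<open>borel_prod\<close>). As \<open>measure_of\<close> would silently produce the zero measure
  from a set function that is not a measure, \<open>emeasure_joint\<close> confirms the defining formula.
\<close>

definition joint :: "(real^'n) measure \<Rightarrow> (real^'n \<Rightarrow> (real^'m) measure)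
    \<Rightarrow> ((real^'n) \<times> (real^'m)) measure" where
  "joint P Q = measure_of UNIV (sets borel)
     (\<lambda>A. \<integral>\<^sup>+ x. emeasure (Q x) {y. (x, y) \<in> A} \<partial>P)"

lemma sets_joint: "sets (joint P Q) = sets borel"
  unfolding joint_def
  using sets.sigma_sets_eq[of "borel :: ((real^'a) \<times> (real^'b)) measure"] by simp

lemma emeasure_joint:
  fixes P :: "(real^'n) measure" and Q :: "real^'n \<Rightarrow> (real^'m) measure"
  assumes P: "sets P = sets borel" and Q: "channel Q" and A: "A \<in> sets borel"
  shows "emeasure (joint P Q) A = (\<integral>\<^sup>+ x. emeasure (Q x) {y. (x, y) \<in> A} \<partial>P)"
proof -
  let ?f = "\<lambda>A. \<integral>\<^sup>+ x. emeasure (Q x) {y. (x, y) \<in> A} \<partial>P"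
  have bp: "sets (borel \<Otimes>\<^sub>M borel) = sets (borel :: ((real^'n) \<times> (real^'m)) measure)"
    by (rule arg_cong[OF borel_prod])
  have setsQ: "sets (Q x) = sets borel" for x using Q by (simp add: channel_def)
  have Qm: "Q \<in> borel \<rightarrow>\<^sub>M subprob_algebra borel"
    using Q by (simp add: channel_iff_prob_algebra measurable_prob_algebraD)
  have sec: "{y. (x, y) \<in> B} \<in> sets (Q x)"
    if "B \<in> sets (borel :: ((real^'n) \<times> (real^'m)) measure)" for B x
  proof -
    have "Pair x -` B \<in> sets (borel :: (real^'m) measure)"
      using that by (intro sets_Pair1[of B borel borel]) (simp only: bp)
    moreover have "Pair x -` B = {y. (x, y) \<in> B}" by auto
    ultimately show ?thesis by (simp add: setsQ)
  qed
  have meas: "(\<lambda>x. emeasure (Q x) {y. (x, y) \<in> B}) \<in> borel_measurable P"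
    if "B \<in> sets (borel :: ((real^'n) \<times> (real^'m)) measure)" for B
  proof -
    have "(SIGMA x:space borel. {y. (x, y) \<in> B}) = B" by auto
    then have "(\<lambda>x. emeasure (Q x) {y. (x, y) \<in> B}) \<in> borel_measurable borel"
      using that by (intro emeasure_measurable_subprob_algebra2[OF _ Qm]) (simp only: bp)
    then show ?thesis by (simp add: P cong: measurable_cong_sets)
  qed
  have "countably_additive (sets borel) ?f"
  proof (rule countably_additiveI)
    fix B :: "nat \<Rightarrow> ((real^'n) \<times> (real^'m)) set"
    assume B: "range B \<subseteq> sets borel" "disjoint_family B"
    have "(\<Sum>i. ?f (B i)) = (\<integral>\<^sup>+ x. (\<Sum>i. emeasure (Q x) {y. (x, y) \<in> B i}) \<partial>P)"
      using B by (intro nn_integral_suminf[symmetric] meas) auto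
    also have "\<dots> = ?f (\<Union>i. B i)"
    proof (rule nn_integral_cong)
      fix x
      have "(\<Sum>i. emeasure (Q x) {y. (x, y) \<in> B i}) = emeasure (Q x) (\<Union>i. {y. (x, y) \<in> B i})"
        using B by (intro suminf_emeasure) (auto simp: sec disjoint_family_on_def)
      also have "(\<Union>i. {y. (x, y) \<in> B i}) = {y. (x, y) \<in> (\<Union>i. B i)}" by auto
      finally show "(\<Sum>i. emeasure (Q x) {y. (x, y) \<in> B i}) = emeasure (Q x) {y. (x, y) \<in> (\<Union>i. B i)}" .
    qed
    finally show "(\<Sum>i. ?f (B i)) = ?f (\<Union>i. B i)" .
  qed
  moreover have "positive (sets borel) ?f" by (simp add: positive_def)
  ultimately show ?thesis
    using A sets_joint[of P Q]
    by (intro emeasure_measure_of[OF joint_def]) auto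
qed

definition setwise_converges_at ::
  "(real^'n) measure \<Rightarrow> (nat \<Rightarrow> real^'n \<Rightarrow> (real^'m) measure)
    \<Rightarrow> (real^'n \<Rightarrow> (real^'m) measure) \<Rightarrow> bool" where
  "setwise_converges_at P Qs Q \<longleftrightarrow>
     (\<forall>A \<in> sets borel. (\<lambda>k. measure (joint P (Qs k)) A) \<longlonglongrightarrow> measure (joint P Q) A)"

text \<open>The limit channel is not required to belong to the set.\<close>

definition setwise_precompact_at ::
  "(real^'n) measure \<Rightarrow> (real^'n \<Rightarrow> (real^'m) measure) set \<Rightarrow> bool" where
  "setwise_precompact_at P \<Q> \<longleftrightarrow>
     (\<forall>Qs. (\<forall>k. Qs k \<in> \<Q>) \<longrightarrow>
        (\<exists>r Q. strict_mono (r :: nat \<Rightarrow> nat) \<and> channel Q \<and> setwise_converges_at P (Qs \<circ> r) Q))"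

end

theory Submission
  imports Defs "HOL-Complex_Analysis.Great_Picard"
begin

text \<open>
  Why the theorem holds. Write \<open>\<mu>\<^sub>k = PQ\<^sub>k\<close> for a sequence of channels in the given set.

  A limit measure exists because domination by one finite measure makes the \<open>\<mu>\<^sub>k\<close> uniformly
  countably additive. The Borel sets have a countable generator closed under intersection, and a
  diagonal argument yields a subsequence along which \<open>\<mu>\<^sub>k(A)\<close> converges for each \<open>A\<close> in it. The sets
  on which \<open>\<mu>\<^sub>k(A)\<close> converges form a Dynkin system: for a disjoint union the series
  \<open>\<Sum>i. \<mu>\<^sub>k(A\<^sub>i)\<close> has the summable majorant \<open>\<Sum>i. \<nu>(A\<^sub>i)\<close>, so its limit in \<open>k\<close> may be taken term by
  term (lemma \<open>tendsto_measure_disjoint_UN\<close>). Hence \<open>\<mu>\<^sub>k(A)\<close> converges for every Borel set \<open>A\<close>, and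
  the same exchange of limits shows that the limit \<open>\<mu>\<close> is a measure
  (lemma \<open>dominated_measures_setwise_compact\<close>).

  It remains to write \<open>\<mu>\<close> as \<open>PQ\<close>. The Radon-Nikodym theorem provides \<open>Q\<close>, because \<open>\<mu>\<close> is
  absolutely continuous with respect to \<open>PR\<close> for a single channel \<open>R\<close>:
  the mixture \<open>R = \<Sum>k. 2\<^sup>-\<^sup>k\<^sup>-\<^sup>1 Q\<^sub>k\<close>. A \<open>PR\<close>-null set is null for every \<open>\<mu>\<^sub>k\<close>, hence for the setwise limit
  \<open>\<mu>\<close> (lemma \<open>channel_mixture\<close>). Let \<open>f\<close> be the density of \<open>\<mu>\<close> with respect to \<open>PR\<close>. As every \<open>\<mu>\<^sub>k\<close>
  has first marginal \<open>P\<close>, so has \<open>\<mu>\<close>, which says that \<open>\<integral> f(x,y) R(dy|x) = 1\<close> for \<open>P\<close>-almost every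
  \<open>x\<close>. Therefore \<open>Q(dy|x) = f(x,y) R(dy|x)\<close>, with \<open>R(\<cdot>|x)\<close> itself on the exceptional null set,
  is a channel with \<open>PQ = \<mu>\<close> (lemmas \<open>channel_of_density\<close> and
  \<open>disintegration_absolutely_continuous\<close>).
\<close>

section \<open>Setwise limits of dominated sequences of measures\<close>

text \<open>
  A countable basis of the topology generates the Borel sets; its finite intersections are still
  countably many, and the empty intersection contributes the whole space.
\<close>

lemma countable_Int_stable_generator_borel:
  obtains G :: "'a::second_countable_topology set set"
  where "countable G" "Int_stable G" "UNIV \<in> G" "sets borel = sigma_sets UNIV G"
proof -
  obtain B :: "'a set set" where B: "countable B" "topological_basis B"
    using ex_countable_basis by blast
  define G where "G = Inter ` {F. finite F \<and> F \<subseteq> B}"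
  show thesis
  proof
    show "countable G"
      unfolding G_def by (intro countable_image countable_Collect_finite_subset B)
    show "Int_stable G"
      unfolding G_def
    proof (rule Int_stableI_image)
      fix F F' assume "F \<in> {F. finite F \<and> F \<subseteq> B}" "F' \<in> {F. finite F \<and> F \<subseteq> B}"
      then show "\<exists>H\<in>{F. finite F \<and> F \<subseteq> B}. \<Inter>F \<inter> \<Inter>F' = \<Inter>H"
        by (intro bexI[of _ "F \<union> F'"]) auto
    qed
    show "UNIV \<in> G"
      unfolding G_def by (intro image_eqI[of _ _ "{}"]) auto
    show "sets borel = sigma_sets UNIV G"
    proof
      have "B \<subseteq> G"
      proof
        fix b assume "b \<in> B"
        then show "b \<in> G"
          unfolding G_def by (intro image_eqI[of _ _ "{b}"]) auto
      qed
      then have "sigma_sets UNIV B \<subseteq> sigma_sets UNIV G"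
        by (rule sigma_sets_mono')
      then show "sets borel \<subseteq> sigma_sets UNIV G"
        unfolding borel_eq_countable_basis[OF B] by simp
      have "open g" if "g \<in> G" for g
        using that B(2) by (auto simp: G_def intro!: open_Inter dest: topological_basis_open)
      then have "G \<subseteq> sets borel" by auto
      then show "sigma_sets UNIV G \<subseteq> sets borel"
        using sets.sigma_sets_subset[of G borel] by simp
    qed
  qed
qed

text \<open>
  Tannery's theorem, i.e. dominated convergence for series: the terms \<open>M k (A i)\<close> are bounded,
  uniformly in \<open>k\<close>, by the summable sequence \<open>\<nu> (A i)\<close>. Applied below twice, once to propagate
  convergence to disjoint unions and once to obtain countable additivity of the limit.
\<close>

lemma tendsto_measure_disjoint_UN:
  fixes M :: "nat \<Rightarrow> 'a measure"
  assumes fin: "\<And>k. finite_measure (M k)" "finite_measure \<nu>"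
    and sets: "\<And>k. sets (M k) = sets \<nu>"
    and le: "\<And>k A. A \<in> sets \<nu> \<Longrightarrow> measure (M k) A \<le> measure \<nu> A"
    and A: "range A \<subseteq> sets \<nu>" "disjoint_family A"
    and lim: "\<And>i. (\<lambda>k. measure (M k) (A i)) \<longlonglongrightarrow> l i"
  shows "(\<lambda>k. measure (M k) (\<Union>i. A i)) \<longlonglongrightarrow> (\<Sum>i. l i)" and "summable l"
proof -
  have sums: "(\<lambda>i. measure N (A i)) sums measure N (\<Union>i. A i)"
    if "finite_measure N" "sets N = sets \<nu>" for N
    using that A by (intro finite_measure.finite_measure_UNION) auto
  have "eventually (\<lambda>k. summable (\<lambda>i. norm (measure (M k) (A i)))) sequentially \<and>
     summable (\<lambda>i. norm (l i)) \<and>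
     (\<lambda>k. \<Sum>i. measure (M k) (A i)) \<longlonglongrightarrow> suminf l"
  proof (rule tannerys_theorem)
    show "\<forall>\<^sub>F (i, k) in sequentially \<times>\<^sub>F sequentially. norm (measure (M k) (A i)) \<le> measure \<nu> (A i)"
      using A by (intro always_eventually) (auto intro!: le)
    show "summable (\<lambda>i. measure \<nu> (A i))"
      using sums[OF fin(2) refl] by (rule sums_summable)
  qed (use lim in auto)
  then show "(\<lambda>k. measure (M k) (\<Union>i. A i)) \<longlonglongrightarrow> (\<Sum>i. l i)" "summable l"
    using sums[OF fin(1) sets] by (auto simp: sums_iff dest: summable_rabs_cancel)
qed

text \<open>
  Diagonal extraction gives convergence on a countable generator, and Dynkin's \<open>\<pi>\<close>-\<open>\<lambda>\<close> argument
  extends it to all Borel sets. The whole space lies in the generator, so that total masses converge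
  as well; closure under complements uses this.
\<close>

lemma dominated_measures_setwise_compact:
  fixes M :: "nat \<Rightarrow> 'a::second_countable_topology measure"
  assumes fin: "\<And>k. finite_measure (M k)" and \<nu>: "finite_measure \<nu>"
    and sets_M: "\<And>k. sets (M k) = sets borel" and sets_\<nu>: "sets \<nu> = sets borel"
    and le: "\<And>k A. A \<in> sets borel \<Longrightarrow> emeasure (M k) A \<le> emeasure \<nu> A"
  obtains r :: "nat \<Rightarrow> nat" and \<mu> :: "'a measure"
  where "strict_mono r" "finite_measure \<mu>" "sets \<mu> = sets borel"
    "\<And>A. A \<in> sets borel \<Longrightarrow> (\<lambda>k. measure (M (r k)) A) \<longlonglongrightarrow> measure \<mu> A"
proof -
  interpret \<nu>: finite_measure \<nu> by fact
  have le': "measure (M k) A \<le> measure \<nu> A" if "A \<in> sets borel" for k A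
    using le[OF that, of k] finite_measure.emeasure_eq_measure[OF fin, of k A]
    by (simp add: \<nu>.emeasure_eq_measure)
  obtain G :: "'a set set" where G: "countable G" "Int_stable G" "UNIV \<in> G"
    "sets borel = sigma_sets UNIV G"
    by (rule countable_Int_stable_generator_borel)
  have G_borel: "A \<in> sets borel" if "A \<in> G" for A
    using that G(4) by auto
  obtain r where r: "strict_mono (r::nat\<Rightarrow>nat)"
    and conv_G: "\<And>A. A \<in> G \<Longrightarrow> \<exists>l. (\<lambda>k. measure (M (r k)) A) \<longlonglongrightarrow> l"
  proof (rule function_convergent_subsequence[OF G(1), of "\<lambda>k. measure (M k)" "measure \<nu> UNIV"])
    fix k A assume "A \<in> G"
    then show "norm (measure (M k) A) \<le> measure \<nu> UNIV"
      using order_trans[OF le'[of A k] \<nu>.bounded_measure[of A]] sets_eq_imp_space_eq[OF sets_\<nu>]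
      by (simp add: G_borel)
  qed blast
  have UN: "(\<lambda>k. measure (M (r k)) (\<Union>i. A i)) \<longlonglongrightarrow> (\<Sum>i. l i)" "summable l"
    if "range A \<subseteq> sets borel" "disjoint_family A" "\<And>i. (\<lambda>k. measure (M (r k)) (A i)) \<longlonglongrightarrow> l i"
    for A :: "nat \<Rightarrow> 'a set" and l
    using tendsto_measure_disjoint_UN[of "\<lambda>k. M (r k)" \<nu> A l] that
    by (simp_all add: fin \<nu> sets_M sets_\<nu> le')
  define L where "L A = lim (\<lambda>k. measure (M (r k)) A)" for A
  have L: "(\<lambda>k. measure (M (r k)) A) \<longlonglongrightarrow> L A" if "A \<in> sets borel" for A
  proof -
    have "G \<subseteq> Pow UNIV" "A \<in> sigma_sets UNIV G" using that G(4) by simp_all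
    with G(2) have "convergent (\<lambda>k. measure (M (r k)) A)"
    proof (induction rule: sigma_sets_induct_disjoint)
      case (compl A)
      have "measure (M (r k)) (UNIV - A) = measure (M (r k)) UNIV - measure (M (r k)) A" for k
        using finite_measure.finite_measure_compl[OF fin, of A "r k"] compl(1) G(4)
          sets_eq_imp_space_eq[OF sets_M, of "r k"] by (simp add: sets_M)
      then show ?case
        using compl(2) conv_G[OF G(3)] by (auto simp: convergent_def intro: tendsto_diff)
    next
      case (union A)
      then obtain l where "\<And>i. (\<lambda>k. measure (M (r k)) (A i)) \<longlonglongrightarrow> l i"
        unfolding convergent_def by metis
      then show ?case
        using union UN(1)[of A l] G(4) by (auto simp: convergent_def)
    qed (use conv_G in \<open>auto simp: convergent_def\<close>)
    then show ?thesis by (simp add: L_def convergent_LIMSEQ_iff)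
  qed
  have L_nonneg: "0 \<le> L A" if "A \<in> sets borel" for A
    using L[OF that] by (rule LIMSEQ_le_const) auto
  define \<mu> where "\<mu> = measure_of UNIV (sets borel) (\<lambda>A. ennreal (L A))"
  have sets_\<mu>: "sets \<mu> = sets borel"
    unfolding \<mu>_def using sets.sigma_sets_eq[of "borel :: 'a measure"] by simp
  have em: "emeasure \<mu> A = ennreal (L A)" if "A \<in> sets borel" for A
  proof (rule emeasure_measure_of[OF \<mu>_def])
    have "L {} = 0" using L[of "{}"] by (simp add: LIMSEQ_const_iff)
    then show "positive (sets \<mu>) (\<lambda>A. ennreal (L A))" by (simp add: positive_def)
    show "countably_additive (sets \<mu>) (\<lambda>A. ennreal (L A))"
    proof (rule countably_additiveI)
      fix A :: "nat \<Rightarrow> 'a set" assume A: "range A \<subseteq> sets \<mu>" "disjoint_family A"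
      then have A': "range A \<subseteq> sets borel" by (simp add: sets_\<mu>)
      then have Ai: "A i \<in> sets borel" for i by auto
      note UN = UN[OF A' A(2) L[OF Ai]]
      have "(\<Sum>i. ennreal (L (A i))) = ennreal (\<Sum>i. L (A i))"
        using UN(2) Ai by (intro suminf_ennreal2 L_nonneg)
      also have "(\<Sum>i. L (A i)) = L (\<Union>i. A i)"
        using UN(1) L[of "\<Union>i. A i"] Ai by (intro LIMSEQ_unique) auto
      finally show "(\<Sum>i. ennreal (L (A i))) = ennreal (L (\<Union>i. A i))" .
    qed
  qed (use that sets_\<mu> in auto)
  show thesis
  proof
    show "finite_measure \<mu>"
      by (rule finite_measureI) (simp add: em sets_eq_imp_space_eq[OF sets_\<mu>])
    show "(\<lambda>k. measure (M (r k)) A) \<longlonglongrightarrow> measure \<mu> A" if "A \<in> sets borel" for A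
      using L[OF that] by (simp add: measure_def em[OF that] L_nonneg that)
  qed (use r sets_\<mu> in auto)
qed

section \<open>Integration with respect to joint measures\<close>

lemma channel_simps:
  assumes "channel Q"
  shows sets_channel: "sets (Q x) = sets borel" and space_channel: "space (Q x) = UNIV"
    and emeasure_channel_UNIV: "emeasure (Q x) UNIV = 1"
proof -
  show sets: "sets (Q x) = sets borel" using assms by (simp add: channel_def)
  then show sp: "space (Q x) = UNIV" using sets_eq_imp_space_eq[OF sets] by simp
  show "emeasure (Q x) UNIV = 1"
    using assms prob_space.emeasure_space_1[of "Q x"] by (simp add: channel_def sp)
qed

lemma measurable_channel_subprob: "channel Q \<Longrightarrow> Q \<in> borel \<rightarrow>\<^sub>M subprob_algebra borel"
  by (simp add: channel_iff_prob_algebra measurable_prob_algebraD)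

lemma borel_section:
  fixes A :: "('a::second_countable_topology \<times> 'b::second_countable_topology) set"
  assumes "A \<in> sets borel"
  shows "{y. (x, y) \<in> A} \<in> sets borel"
proof -
  have "Pair x -` A \<in> sets (borel :: 'b measure)"
    using assms by (intro sets_Pair1[of A borel borel]) (simp only: borel_prod)
  then show ?thesis by (simp add: vimage_def)
qed

lemma borel_measurable_slice:
  fixes f :: "('a::second_countable_topology \<times> 'b::second_countable_topology) \<Rightarrow> ennreal"
  assumes "f \<in> borel_measurable borel" and "sets M = sets borel"
  shows "(\<lambda>y. f (x, y)) \<in> borel_measurable M"
proof -
  have "f \<in> borel_measurable (borel \<Otimes>\<^sub>M borel)" using assms by (simp add: borel_prod)
  then have "(\<lambda>y. f (x, y)) \<in> borel_measurable borel" by measurable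
  then show ?thesis by (simp add: assms cong: measurable_cong_sets)
qed

lemma borel_measurable_channel_integral:
  fixes R :: "real^'n \<Rightarrow> (real^'m) measure" and f :: "(real^'n) \<times> (real^'m) \<Rightarrow> ennreal"
  assumes "channel R" and "f \<in> borel_measurable borel"
  shows "(\<lambda>x. \<integral>\<^sup>+ y. f (x, y) \<partial>R x) \<in> borel_measurable borel"
  using assms(2)
  by (intro nn_integral_measurable_subprob_algebra2[OF _ measurable_channel_subprob[OF assms(1)]])
     (simp add: borel_prod)

text \<open>
  The joint measure is the monadic composition of \<open>P\<close> with the kernel \<open>\<delta>\<^sub>x \<otimes> Q x\<close>; in this form the
  iterated-integral formula extends from indicators to all nonnegative functions.
\<close>

lemma nn_integral_joint:
  fixes P :: "(real^'n) measure" and Q :: "real^'n \<Rightarrow> (real^'m) measure"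
  assumes P: "sets P = sets borel" and Q: "channel Q" and f: "f \<in> borel_measurable borel"
  shows "(\<integral>\<^sup>+ z. f z \<partial>joint P Q) = (\<integral>\<^sup>+ x. \<integral>\<^sup>+ y. f (x, y) \<partial>Q x \<partial>P)"
proof -
  have sp: "space P = UNIV" using sets_eq_imp_space_eq[OF P] by simp
  have Pair_m: "Pair x \<in> Q x \<rightarrow>\<^sub>M borel" for x
  proof -
    have "Pair x \<in> (borel :: (real^'m) measure) \<rightarrow>\<^sub>M borel \<Otimes>\<^sub>M borel" by simp
    then show ?thesis
      by (simp add: borel_prod sets_channel[OF Q] cong: measurable_cong_sets)
  qed
  have "case_prod Pair \<in> (borel \<Otimes>\<^sub>M borel :: ((real^'n) \<times> (real^'m)) measure) \<rightarrow>\<^sub>M borel"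
    by (simp add: borel_prod id_def)
  from measurable_distr2[OF this measurable_channel_subprob[OF Q]]
  have K: "(\<lambda>x. distr (Q x) borel (Pair x)) \<in> P \<rightarrow>\<^sub>M subprob_algebra borel"
    by (simp add: P cong: measurable_cong_sets)
  have "joint P Q = P \<bind> (\<lambda>x. distr (Q x) borel (Pair x))"
  proof (rule measure_eqI)
    show "sets (joint P Q) = sets (P \<bind> (\<lambda>x. distr (Q x) borel (Pair x)))"
      by (simp add: sets_joint sets_bind[where N=borel] sp)
    fix A assume "A \<in> sets (joint P Q)"
    then have A: "A \<in> sets borel" by (simp add: sets_joint)
    have "Pair x -` A = {y. (x, y) \<in> A}" for x by auto
    then show "emeasure (joint P Q) A = emeasure (P \<bind> (\<lambda>x. distr (Q x) borel (Pair x))) A"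
      by (simp add: emeasure_joint[OF P Q A] emeasure_bind[OF _ K A] sp emeasure_distr[OF Pair_m A]
          space_channel[OF Q])
  qed
  then have "(\<integral>\<^sup>+ z. f z \<partial>joint P Q) = (\<integral>\<^sup>+ x. \<integral>\<^sup>+ z. f z \<partial>distr (Q x) borel (Pair x) \<partial>P)"
    by (simp add: nn_integral_bind[OF f K])
  then show ?thesis by (simp add: nn_integral_distr[OF Pair_m] f)
qed

lemma emeasure_joint_cylinder:
  fixes P :: "(real^'n) measure" and Q :: "real^'n \<Rightarrow> (real^'m) measure"
  assumes P: "sets P = sets borel" and Q: "channel Q" and B: "B \<in> sets borel"
  shows "emeasure (joint P Q) (B \<times> UNIV) = emeasure P B"
proof -
  have "emeasure (Q x) {y. (x, y) \<in> B \<times> UNIV} = indicator B x" for x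
    using emeasure_channel_UNIV[OF Q, of x] by (auto simp: indicator_def)
  then show ?thesis
    using B P by (simp add: emeasure_joint[OF P Q] borel_Times)
qed

section \<open>The limit measure comes from a channel\<close>

text \<open>
  Averaging over an index drawn from a geometric distribution gives every channel positive weight, so
  a null set of the average is null for each of them.
\<close>

lemma channel_mixture:
  fixes Qs :: "nat \<Rightarrow> real^'n \<Rightarrow> (real^'m) measure"
  assumes P: "sets P = sets borel" and Q: "\<And>k. channel (Qs k)"
  obtains R where "channel R"
    "\<And>k A. A \<in> sets borel \<Longrightarrow> emeasure (joint P R) A = 0 \<Longrightarrow> emeasure (joint P (Qs k)) A = 0"
proof
  let ?g = "measure_pmf (geometric_pmf (1/2))"
  define R where "R x = ?g \<bind> (\<lambda>k. Qs k x)" for x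
  have Qm: "Qs k \<in> borel \<rightarrow>\<^sub>M prob_algebra borel" for k
    using Q by (simp add: channel_iff_prob_algebra)
  have "(\<lambda>(x, k). Qs k x) \<in> borel \<Otimes>\<^sub>M count_space UNIV \<rightarrow>\<^sub>M prob_algebra borel"
    using measurable_pair_swap[OF measurable_pair_measure_countable1[of UNIV "\<lambda>(k, x). Qs k x"]] Qm
    by simp
  then have "R \<in> borel \<rightarrow>\<^sub>M prob_algebra borel"
    unfolding R_def
    by (intro measurable_bind_prob_space2[where N="count_space UNIV"] measurable_const)
       (simp_all add: space_prob_algebra measure_pmf.prob_space_axioms)
  then show R: "channel R" by (simp add: channel_iff_prob_algebra)
  fix k :: nat and A :: "((real^'n) \<times> (real^'m)) set"
  assume A: "A \<in> sets borel" and 0: "emeasure (joint P R) A = 0"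
  have meas: "(\<lambda>x. emeasure (R x) {y. (x, y) \<in> A}) \<in> borel_measurable P"
  proof -
    have "(SIGMA x:space borel. {y. (x, y) \<in> A}) = A" by auto
    then have "(\<lambda>x. emeasure (R x) {y. (x, y) \<in> A}) \<in> borel_measurable borel"
      using A \<open>R \<in> _\<close>
      by (intro emeasure_measurable_subprob_algebra2[where N=borel] measurable_prob_algebraD) (simp_all only: borel_prod)
    then show ?thesis by (simp add: P cong: measurable_cong_sets)
  qed
  have "AE x in P. emeasure (R x) {y. (x, y) \<in> A} = 0"
    using 0 meas by (simp add: emeasure_joint[OF P R A] nn_integral_0_iff_AE)
  then have "AE x in P. emeasure (Qs k x) {y. (x, y) \<in> A} = 0"
  proof eventually_elim
    case (elim x)
    have "(\<lambda>k. Qs k x) \<in> ?g \<rightarrow>\<^sub>M subprob_algebra borel"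
      using measurable_space[OF measurable_prob_algebraD[OF Qm], of x] by simp
    with elim have "(\<integral>\<^sup>+ k. emeasure (Qs k x) {y. (x, y) \<in> A} \<partial>?g) = 0"
      by (simp add: R_def emeasure_bind[OF _ _ borel_section[OF A]])
    then have "AE k in ?g. emeasure (Qs k x) {y. (x, y) \<in> A} = 0"
      by (simp add: nn_integral_0_iff_AE)
    then show ?case by (simp add: AE_measure_pmf_iff set_pmf_geometric)
  qed
  then show "emeasure (joint P (Qs k)) A = 0"
    by (simp add: emeasure_joint[OF P Q A] nn_integral_0_iff_AE cong: nn_integral_cong_AE)
qed

lemma channel_of_density:
  fixes P :: "(real^'n) measure" and R :: "real^'n \<Rightarrow> (real^'m) measure"
  assumes P: "sets P = sets borel" and R: "channel R" and f: "f \<in> borel_measurable borel"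
    and mass: "AE x in P. (\<integral>\<^sup>+ y. f (x, y) \<partial>R x) = 1"
  obtains Q where "channel Q" "joint P Q = density (joint P R) f"
proof
  note int = borel_measurable_channel_integral[OF R]
  define h where "h x = (\<integral>\<^sup>+ y. f (x, y) \<partial>R x)" for x
  have h: "h \<in> borel_measurable borel" unfolding h_def by (rule int[OF f])
  \<comment> \<open>On the null set where the mass differs from 1, the value \<open>R x\<close> keeps \<open>Q\<close> a channel.\<close>
  define Q where "Q x = (if h x = 1 then density (R x) (\<lambda>y. f (x, y)) else R x)" for x
  have emQ: "emeasure (Q x) A = (if h x = 1 then \<integral>\<^sup>+ y. f (x, y) * indicator A y \<partial>R x else emeasure (R x) A)"
    if "A \<in> sets borel" for x A
    using that by (simp add: Q_def emeasure_density borel_measurable_slice[OF f] sets_channel[OF R])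
  have setsQ: "sets (Q x) = sets borel" for x by (simp add: Q_def sets_channel[OF R])
  have probQ: "prob_space (Q x)" for x
    using emQ[of UNIV x] sets_eq_imp_space_eq[OF setsQ, of x]
    by (intro prob_spaceI) (simp add: h_def emeasure_channel_UNIV[OF R])
  show Q: "channel Q"
    unfolding channel_def
  proof (intro conjI allI ballI)
    fix A :: "(real^'m) set" assume A: "A \<in> sets borel"
    have "(\<lambda>z. f z * indicator A (snd z)) \<in> borel_measurable borel"
    proof -
      have "f \<in> borel_measurable (borel \<Otimes>\<^sub>M borel)" using f by (simp add: borel_prod)
      then have "(\<lambda>z. f z * indicator A (snd z)) \<in> borel_measurable (borel \<Otimes>\<^sub>M borel)"
        using A by measurable
      then show ?thesis by (simp add: borel_prod)
    qed
    from int[OF this] have [measurable]: "(\<lambda>x. \<integral>\<^sup>+ y. f (x, y) * indicator A y \<partial>R x) \<in> borel_measurable borel"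
      by simp
    have [measurable]: "(\<lambda>x. emeasure (R x) A) \<in> borel_measurable borel"
      using measurable_compose[OF measurable_channel_subprob[OF R] measurable_emeasure_subprob_algebra[OF A]] .
    note h[measurable]
    have "(\<lambda>x. emeasure (Q x) A) \<in> borel_measurable borel"
      unfolding emQ[OF A] by measurable
    then show "(\<lambda>x. measure (Q x) A) \<in> borel_measurable borel"
      unfolding measure_def by measurable
  qed (use setsQ probQ in auto)
  show "joint P Q = density (joint P R) f"
  proof (rule measure_eqI)
    show "sets (joint P Q) = sets (density (joint P R) f)" by (simp add: sets_joint)
    fix A assume "A \<in> sets (joint P Q)"
    then have A: "A \<in> sets borel" by (simp add: sets_joint)
    have ind: "indicator {y. (x, y) \<in> A} y = (indicator A (x, y) :: ennreal)" for x y
      by (simp add: indicator_def)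
    have "emeasure (joint P Q) A = (\<integral>\<^sup>+ x. \<integral>\<^sup>+ y. f (x, y) * indicator A (x, y) \<partial>R x \<partial>P)"
      unfolding emeasure_joint[OF P Q A]
      using mass by (intro nn_integral_cong_AE)
         (auto simp: emQ[OF borel_section[OF A]] h_def ind elim!: eventually_mono)
    also have "\<dots> = (\<integral>\<^sup>+ z. f z * indicator A z \<partial>joint P R)"
      using f A by (intro nn_integral_joint[symmetric] P R) simp
    also have "\<dots> = emeasure (density (joint P R) f) A"
      using f A by (intro emeasure_density[symmetric]) (simp_all add: sets_joint cong: measurable_cong_sets)
    finally show "emeasure (joint P Q) A = emeasure (density (joint P R) f) A" .
  qed
qed

text \<open>
  Disintegration reduces to the Radon-Nikodym theorem as soon as a dominating measure is already
  disintegrated. The marginal of \<open>\<mu>\<close> has density \<open>\<integral> f(x,y) R(dy|x)\<close> with respect to \<open>P\<close>, and it equals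
  \<open>P\<close>, so this density is 1 almost everywhere.
\<close>

lemma disintegration_absolutely_continuous:
  fixes P :: "(real^'n) measure" and R :: "real^'n \<Rightarrow> (real^'m) measure"
  assumes prob: "prob_space P" and P: "sets P = sets borel" and R: "channel R"
    and \<mu>: "sets \<mu> = sets borel" and ac: "absolutely_continuous (joint P R) \<mu>"
    and marginal: "\<And>B. B \<in> sets borel \<Longrightarrow> emeasure \<mu> (B \<times> UNIV) = emeasure P B"
  obtains Q where "channel Q" "joint P Q = \<mu>"
proof -
  interpret P: prob_space P by fact
  have sp: "space P = UNIV" using sets_eq_imp_space_eq[OF P] by simp
  have "emeasure (joint P R) UNIV = 1"
    using emeasure_joint_cylinder[OF P R, of UNIV] P.emeasure_space_1 sp by simp
  then interpret J: prob_space "joint P R"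
    using sets_eq_imp_space_eq[OF sets_joint, of P R] by (intro prob_spaceI) simp
  obtain f where f': "f \<in> borel_measurable (joint P R)" and dens: "density (joint P R) f = \<mu>"
    using J.Radon_Nikodym[OF ac] \<mu> sets_joint by metis
  have f: "f \<in> borel_measurable borel" using f' by (simp add: sets_joint cong: measurable_cong_sets)
  define h where "h x = (\<integral>\<^sup>+ y. f (x, y) \<partial>R x)" for x
  have h: "h \<in> borel_measurable P"
    using borel_measurable_channel_integral[OF R f]
    unfolding h_def by (simp add: P cong: measurable_cong_sets)
  have "density P h = density P (\<lambda>_. 1)"
  proof (rule measure_eqI)
    fix B assume "B \<in> sets (density P h)"
    then have B: "B \<in> sets borel" "B \<in> sets P" by (simp_all add: P)
    have "emeasure (density P h) B = (\<integral>\<^sup>+ x. h x * indicator B x \<partial>P)"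
      using h B by (simp add: emeasure_density)
    also have "\<dots> = (\<integral>\<^sup>+ x. \<integral>\<^sup>+ y. f (x, y) * indicator (B \<times> UNIV) (x, y) \<partial>R x \<partial>P)"
      by (intro nn_integral_cong)
         (simp add: h_def nn_integral_multc borel_measurable_slice[OF f] sets_channel[OF R] indicator_times)
    also have "\<dots> = (\<integral>\<^sup>+ z. f z * indicator (B \<times> UNIV) z \<partial>joint P R)"
      using f B by (intro nn_integral_joint[symmetric] P R borel_measurable_times_ennreal
          borel_measurable_indicator borel_Times) auto
    also have "\<dots> = emeasure \<mu> (B \<times> UNIV)"
      using f' B unfolding dens[symmetric]
      by (intro emeasure_density[symmetric]) (simp_all add: sets_joint borel_Times)
    also have "\<dots> = emeasure (density P (\<lambda>_. 1)) B"
      using marginal[OF B(1)] by (simp add: density_1)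
    finally show "emeasure (density P h) B = emeasure (density P (\<lambda>_. 1)) B" .
  qed simp
  then have "AE x in P. 1 = h x"
    using h P.emeasure_space_1 by (subst (asm) eq_commute, subst (asm) finite_density_unique) simp_all
  then have "AE x in P. h x = 1"
    by eventually_elim simp
  then obtain Q where "channel Q" "joint P Q = density (joint P R) f"
    using channel_of_density[OF P R f] unfolding h_def by blast
  then show thesis using that dens by simp
qed

theorem lemma4p2:
  fixes \<nu> :: "((real^'n) \<times> (real^'m)) measure"
    and P :: "(real^'n) measure"
    and \<Q> :: "(real^'n \<Rightarrow> (real^'m) measure) set"
  assumes "finite_measure \<nu>" and "sets \<nu> = sets borel"
    and "prob_space P" and "sets P = sets borel"
    and "\<forall>Q \<in> \<Q>. channel Q"
    and "\<forall>Q \<in> \<Q>. \<forall>A \<in> sets borel. emeasure (joint P Q) A \<le> emeasure \<nu> A"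
  shows "setwise_precompact_at P \<Q>"
  unfolding setwise_precompact_at_def
proof (intro allI impI)
  fix Qs :: "nat \<Rightarrow> real^'n \<Rightarrow> (real^'m) measure"
  assume "\<forall>k. Qs k \<in> \<Q>"
  then have Qs: "channel (Qs k)"
    and le: "A \<in> sets borel \<Longrightarrow> emeasure (joint P (Qs k)) A \<le> emeasure \<nu> A" for k A
    using assms by auto
  interpret P: prob_space P by fact
  note P = \<open>sets P = sets borel\<close>
  have fin: "finite_measure (joint P (Qs k))" for k
  proof (rule finite_measureI)
    show "emeasure (joint P (Qs k)) (space (joint P (Qs k))) \<noteq> \<infinity>"
      using emeasure_joint_cylinder[OF P Qs, of UNIV k] sets_eq_imp_space_eq[OF sets_joint, of P "Qs k"]
      by (simp add: P.emeasure_eq_measure)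
  qed
  obtain r :: "nat \<Rightarrow> nat" and \<mu> where r: "strict_mono r" and \<mu>: "finite_measure \<mu>" "sets \<mu> = sets borel"
    and lim: "\<And>A. A \<in> sets borel \<Longrightarrow> (\<lambda>k. measure (joint P (Qs (r k))) A) \<longlonglongrightarrow> measure \<mu> A"
  proof (rule dominated_measures_setwise_compact[of "\<lambda>k. joint P (Qs k)" \<nu>])
    fix r and \<mu> :: "((real^'n) \<times> (real^'m)) measure"
    assume "strict_mono (r :: nat \<Rightarrow> nat)" "finite_measure \<mu>" "sets \<mu> = sets borel"
      and "\<And>A. A \<in> sets borel \<Longrightarrow> (\<lambda>k. measure (joint P (Qs (r k))) A) \<longlonglongrightarrow> measure \<mu> A"
    then show thesis by (rule that)
  qed (use fin assms(1,2) sets_joint le in simp_all)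
  interpret \<mu>: finite_measure \<mu> by fact
  obtain R where R: "channel R" and null:
    "\<And>k A. A \<in> sets borel \<Longrightarrow> emeasure (joint P R) A = 0 \<Longrightarrow> emeasure (joint P (Qs k)) A = 0"
  proof (rule channel_mixture[of P Qs])
    fix R assume "channel R"
      and "\<And>k A. A \<in> sets borel \<Longrightarrow> emeasure (joint P R) A = 0 \<Longrightarrow> emeasure (joint P (Qs k)) A = 0"
    then show thesis by (rule that)
  qed (use P Qs in simp_all)
  have "absolutely_continuous (joint P R) \<mu>"
    unfolding absolutely_continuous_def
  proof
    fix A assume "A \<in> null_sets (joint P R)"
    then have A: "A \<in> sets borel" and 0: "emeasure (joint P R) A = 0"
      by (auto simp: null_sets_def sets_joint)
    have "measure \<mu> A = 0"
      using lim[OF A] null[OF A 0] by (simp add: measure_def LIMSEQ_const_iff)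
    then show "A \<in> null_sets \<mu>"
      using A \<mu> by (simp add: null_sets_def \<mu>.emeasure_eq_measure)
  qed
  moreover have "emeasure \<mu> (B \<times> UNIV) = emeasure P B" if B: "B \<in> sets borel" for B
  proof -
    have "(\<lambda>k. measure P B) \<longlonglongrightarrow> measure \<mu> (B \<times> UNIV)"
      using lim[of "B \<times> UNIV"] B
      by (simp add: borel_Times measure_def emeasure_joint_cylinder[OF P Qs B])
    then show ?thesis
      by (simp add: LIMSEQ_const_iff \<mu>.emeasure_eq_measure P.emeasure_eq_measure)
  qed
  ultimately obtain Q where "channel Q" "joint P Q = \<mu>"
    using disintegration_absolutely_continuous[OF \<open>prob_space P\<close> P R \<mu>(2)] by blast
  with r lim show "\<exists>r Q. strict_mono (r :: nat \<Rightarrow> nat) \<and> channel Q \<and> setwise_converges_at P (Qs \<circ> r) Q"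
    by (auto simp: setwise_converges_at_def)
qed

end
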